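(* Let $R,c$ be positive integers with $\gcd(c,R)=1$, and let $m$ be a positive integer. Let $P_0$ be the integer with $1\le P_0<R$ and $cP_0\equiv1\pmod R$, put $S_0=(cP_0-1)/R$, and for integers $t\ge0$ define \[D(t)=(S_0+ct)^2-4(P_0+tR).\] Then there exist primes $u<v$ with $u>m$ and $cuv-R(u+v)=1$ if and only if there exists an integer $t\ge0$ such that $D(t)$ is a perfect square, the numbers \[u=\frac{S_0+ct-\sqrt{D(t)}}2,\qquad v=\frac{S_0+ct+\sqrt{D(t)}}2\] are primes, and $u>m$. *)

theory Defs
  imports Complex_Main "HOL-Number_Theory.Number_Theory"
    "HOL-Computational_Algebra.Nth_Powers"
begin

end

(* The equation says c*P - R*S = 1 for P = u*v, S = u + v; its solutions with P > 0 are exactly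
   P = P0 + t*R, S = S0 + c*t with t >= 0, and u, v are the roots of X^2 - S*X + P, whose
   discriminant is D t. A double root is excluded because it would divide 1. *)
theory Submission
  imports Defs
begin

theorem mainTheorem17:
  fixes R c m P0 S0 :: int and D :: "int \<Rightarrow> int"
  assumes "R > 0" and "c > 0" and "gcd c R = 1" and "m > 0"
    and "1 \<le> P0" and "P0 < R" and "[c * P0 = 1] (mod R)"
    and "S0 = (c * P0 - 1) div R"
    and "\<And>t. t \<ge> 0 \<Longrightarrow> D t = (S0 + c * t)\<^sup>2 - 4 * (P0 + t * R)"
  shows "(\<exists>u v :: int. prime u \<and> prime v \<and> u < v \<and> u > m \<and> c * u * v - R * (u + v) = 1)
    \<longleftrightarrow> (\<exists>t \<ge> 0. is_square (D t) \<and>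
          (\<exists>u v :: int.
             real_of_int u = (real_of_int (S0 + c * t) - sqrt (real_of_int (D t))) / 2 \<and>
             real_of_int v = (real_of_int (S0 + c * t) + sqrt (real_of_int (D t))) / 2 \<and>
             prime u \<and> prime v \<and> u > m))"
    (is "?L \<longleftrightarrow> ?R")
proof -
  have "R dvd c * P0 - 1"
    using assms(7) by (simp add: cong_iff_dvd_diff)
  \<comment> \<open>The \<open>div\<close> in \<open>S0\<close> is exact, so \<open>(P0, S0)\<close>
    is itself a solution of \<open>c * P - R * S = 1\<close>.\<close>
  then have S0: "R * S0 = c * P0 - 1"
    using assms(8) by simp
  show ?thesis
  proof
    assume ?L
    then obtain u v :: int where uv: "prime u" "prime v" "u < v" "u > m"
      and eq: "c * u * v - R * (u + v) = 1" by blast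
    \<comment> \<open>Difference of the two solutions \<open>(u * v, u + v)\<close> and
      \<open>(P0, S0)\<close>; coprimality of \<open>R\<close> and \<open>c\<close> then makes
      \<open>R\<close> divide the first factor.\<close>
    have "c * (u * v - P0) = R * (u + v - S0)"
      using eq S0 by (simp add: algebra_simps)
    then have "R dvd c * (u * v - P0)" by simp
    moreover have "coprime R c"
      using assms(3) by (simp add: coprime_iff_gcd_eq_1 gcd.commute)
    ultimately have "R dvd u * v - P0"
      by (simp add: coprime_dvd_mult_right_iff)
    then obtain t where "u * v - P0 = R * t" by (elim dvdE)
    then have P: "u * v = P0 + t * R" by (simp add: algebra_simps)
    have "R * (u + v) = R * (S0 + c * t)"
    proof -
      have "R * (u + v) = c * (u * v) - 1" using eq by (simp add: algebra_simps)
      also have "\<dots> = R * (S0 + c * t)" unfolding P using S0 by (simp add: algebra_simps)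
      finally show ?thesis .
    qed
    then have S: "S0 + c * t = u + v" using assms(1) by simp
    have "u * v > 0" using uv(1,2) by (simp add: prime_gt_0_int)
    \<comment> \<open>Positivity of \<open>u * v\<close> gives \<open>t * R > - P0\<close>, and
      \<open>P0 < R\<close> turns this into \<open>t > -1\<close>; this is where the choice of the
      least positive \<open>P0\<close> matters.\<close>
    then have "R * (-1) < R * t"
      using P assms(6) by (simp add: algebra_simps)
    then have t: "t \<ge> 0" unfolding mult_less_cancel_left_pos[OF assms(1)] by linarith
    have Dt: "D t = (v - u)\<^sup>2"
      unfolding assms(9)[OF t] S P[symmetric] by (simp add: power2_eq_square algebra_simps)
    \<comment> \<open>The order \<open>u < v\<close> fixes the sign of the root, so \<open>u\<close>
      gets the minus sign and \<open>v\<close> the plus sign.\<close>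
    then have "sqrt (real_of_int (D t)) = real_of_int (v - u)"
      using uv(3) by simp
    moreover have "is_square (D t)" using Dt by simp
    ultimately show ?R
      using t S uv by (intro exI[of _ t] exI[of _ u] exI[of _ v] conjI) auto
  next
    assume ?R
    then obtain t u v where t: "t \<ge> 0" and sq: "is_square (D t)"
      and u: "real_of_int u = (real_of_int (S0 + c * t) - sqrt (real_of_int (D t))) / 2"
      and v: "real_of_int v = (real_of_int (S0 + c * t) + sqrt (real_of_int (D t))) / 2"
      and pr: "prime u" "prime v" "u > m" by blast
    from sq obtain w where w: "D t = w\<^sup>2" by (auto elim: is_nth_powerE)
    \<comment> \<open>The witness \<open>w\<close> of squareness may be negative, hence the absolute
      value.\<close>
    have sqrtD: "sqrt (real_of_int (D t)) = real_of_int \<bar>w\<bar>" by (simp add: w)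
    have "real_of_int (u + v) = real_of_int (S0 + c * t)"
      using u v by simp
    then have S: "u + v = S0 + c * t" by linarith
    have "real_of_int (v - u) = real_of_int \<bar>w\<bar>"
      using u v sqrtD by (simp add: field_simps)
    then have d: "v - u = \<bar>w\<bar>" by linarith
    \<comment> \<open>Comparison with \<open>(v - u)\<^sup>2 = (u + v)\<^sup>2 - 4 * u * v\<close>
      recovers the product from the discriminant.\<close>
    have "(v - u)\<^sup>2 = (u + v)\<^sup>2 - 4 * (P0 + t * R)"
      using w assms(9)[OF t] by (simp add: d S)
    then have P: "u * v = P0 + t * R"
      by (simp add: power2_eq_square algebra_simps)
    have eq: "c * u * v - R * (u + v) = 1"
    proof -
      have "c * u * v - R * (u + v) = c * (P0 + t * R) - R * (S0 + c * t)"
        using P S by (simp add: mult.assoc)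
      also have "\<dots> = 1" using S0 by (simp add: algebra_simps)
      finally show ?thesis .
    qed
    have "u \<noteq> v"
    proof
      assume "u = v"
      then have "u * (c * u - 2 * R) = 1" using eq by (simp add: algebra_simps)
      then have "u dvd 1" by (metis dvd_triv_left)
      then show False using pr(1) not_prime_unit by blast
    qed
    \<comment> \<open>The difference \<open>\<bar>w\<bar>\<close> is nonnegative, and zero has just
      been ruled out.\<close>
    then have "u < v" using d by linarith
    then show ?L using pr eq by blast
  qed
qed

end
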